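(* Let $n\ge1$ and let $D_0(n)$ denote either of the checkered diagrams $Ch^1_n$ or $Ch^2_n$. (a) If $n$ is even, then $|Min(D_0(n))|=1$. (b) If $n$ is odd, then $|Min(D_0(n))|=\binom{2m}{m}$, where $m=\lfloor n/2\rfloor$.
   Context: A diagram is a finite set $D$ of cells $(r,c)$ with $r,c$ positive integers; $r$ is the row (rows numbered from bottom to top starting at 1) and $c$ the column (numbered from left to right starting at 1). A Kohnert move at row $r$ applied to a diagram $D$: if row $r$ of $D$ is empty, $D$ is unchanged; otherwise let $(r,c)$ be the cell of row $r$ with the largest column index; if every position $(r',c)$ with $1\le r'<r$ belongs to $D$, then $D$ is unchanged; otherwise let $r'$ be the largest integer with $1\le r'<r$ and $(r',c)\notin D$, and the move replaces the cell $(r,c)$ by $(r',c)$. For a diagram $D_0$, $KD(D_0)$ is the set of all diagrams obtainable from $D_0$ by finite (possibly empty) sequences of Kohnert moves; the Kohnert poset $\mathcal{P}(D_0)$ is $KD(D_0)$ ordered by $D_2\preceq D_1$ iff $D_2$ can be obtained from $D_1$ by a finite sequence of Kohnert moves; $Min(D_0)$ is the set of its minimal elements. Checkered diagrams: $Ch^1_n=\{(2i-1,2j-1):1\le i,j\le\lceil n/2\rceil\}\cup\{(2i,2j):1\le i,j\le\lfloor n/2\rfloor\}$ and $Ch^2_n=\{(2i-1,2j):1\le i\le\lceil n/2\rceil,\ 1\le j\le\lfloor n/2\rfloor\}\cup\{(2i,2j-1):1\le i\le\lfloor n/2\rfloor,\ 1\le j\le\lceil n/2\rceil\}$. *)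

theory Defs
  imports Complex_Main
begin

text \<open>A cell is a pair (row, column); rows are numbered from bottom to top and columns from left
  to right, both starting at 1.  The type does not enforce finiteness or positivity; the predicate
  \<open>is_diagram\<close> does, and it holds for the checkered diagrams and is preserved by Kohnert moves.\<close>

type_synonym diagram = "(nat \<times> nat) set"

definition is_diagram :: "diagram \<Rightarrow> bool" where
  "is_diagram D \<longleftrightarrow> finite D \<and> (\<forall>(r, c)\<in>D. 1 \<le> r \<and> 1 \<le> c)"

definition row_columns :: "nat \<Rightarrow> diagram \<Rightarrow> nat set" where
  "row_columns r D = {c. (r, c) \<in> D}"

definition free_rows_below :: "nat \<Rightarrow> nat \<Rightarrow> diagram \<Rightarrow> nat set" where
  "free_rows_below r c D = {r'. 1 \<le> r' \<and> r' < r \<and> (r', c) \<notin> D}"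

definition kohnert_move :: "nat \<Rightarrow> diagram \<Rightarrow> diagram" where
  "kohnert_move r D =
    (if row_columns r D = {} then D
     else let c = Max (row_columns r D) in
       if free_rows_below r c D = {} then D
       else insert (Max (free_rows_below r c D), c) (D - {(r, c)}))"

definition kohnert_step :: "diagram \<Rightarrow> diagram \<Rightarrow> bool" where
  "kohnert_step D D' \<longleftrightarrow> (\<exists>r\<ge>1. D' = kohnert_move r D)"

definition kohnert_le :: "diagram \<Rightarrow> diagram \<Rightarrow> bool"  (infix "\<preceq>\<^sub>K" 50) where
  "D2 \<preceq>\<^sub>K D1 \<longleftrightarrow> kohnert_step\<^sup>*\<^sup>* D1 D2"

definition KD :: "diagram \<Rightarrow> diagram set" where
  "KD D0 = {D. kohnert_step\<^sup>*\<^sup>* D0 D}"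

definition kohnert_minimal :: "diagram \<Rightarrow> diagram set" where
  "kohnert_minimal D0 = {D \<in> KD D0. \<forall>E\<in>KD D0. E \<preceq>\<^sub>K D \<longrightarrow> E = D}"

text \<open>For a natural number \<open>n\<close>, \<open>(n + 1) div 2\<close> is the ceiling and \<open>n div 2\<close> the floor of half
  of \<open>n\<close>.\<close>

definition checkered1 :: "nat \<Rightarrow> diagram" where
  "checkered1 n =
     {(2 * i - 1, 2 * j - 1) | i j. i \<in> {1..(n + 1) div 2} \<and> j \<in> {1..(n + 1) div 2}} \<union>
     {(2 * i, 2 * j) | i j. i \<in> {1..n div 2} \<and> j \<in> {1..n div 2}}"

definition checkered2 :: "nat \<Rightarrow> diagram" where
  "checkered2 n =
     {(2 * i - 1, 2 * j) | i j. i \<in> {1..(n + 1) div 2} \<and> j \<in> {1..n div 2}} \<union>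
     {(2 * i, 2 * j - 1) | i j. i \<in> {1..n div 2} \<and> j \<in> {1..(n + 1) div 2}}"

lemma is_diagram_checkered:
  "is_diagram (checkered1 n)" "is_diagram (checkered2 n)"
proof -
  have "checkered1 n \<subseteq> {1..n + 1} \<times> {1..n + 1}" "checkered2 n \<subseteq> {1..n + 1} \<times> {1..n + 1}"
    by (auto simp: checkered1_def checkered2_def)
  then show "is_diagram (checkered1 n)" "is_diagram (checkered2 n)"
    unfolding is_diagram_def by (auto intro: finite_subset)
qed

lemma is_diagram_kohnert_move:
  assumes "is_diagram D"
  shows "is_diagram (kohnert_move r D)"
proof (cases "row_columns r D = {} \<or> free_rows_below r (Max (row_columns r D)) D = {}")
  case True
  then show ?thesis using assms by (auto simp: kohnert_move_def Let_def)
next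
  case False
  define c where "c = Max (row_columns r D)"
  have "row_columns r D \<subseteq> snd ` D"
    by (force simp: row_columns_def)
  then have "finite (row_columns r D)"
    using assms finite_surj unfolding is_diagram_def by blast
  then have "(r, c) \<in> D"
    using Max_in[of "row_columns r D"] False by (auto simp: c_def row_columns_def)
  moreover have "finite (free_rows_below r c D)"
    by (simp add: free_rows_below_def)
  then have "Max (free_rows_below r c D) \<in> free_rows_below r c D"
    using False by (intro Max_in) (auto simp: c_def)
  ultimately show ?thesis
    using assms False
    by (auto simp: kohnert_move_def Let_def is_diagram_def free_rows_below_def simp flip: c_def)
qed

end

theory Submission
  imports Defs "HOL-Library.FuncSet"
begin

text \<open>A diagram is minimal iff no move changes it, and then every cell lies weakly to the left of a
  column that is full from row 1 up to the row of that cell.  For even \<open>n\<close> all columns have the same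
  size, which leaves a single rectangle.  For \<open>n = 2m + 1\<close> the sets \<open>X\<close> and \<open>Y\<close> of columns with \<open>m\<close>
  and \<open>m + 1\<close> cells alternate; a minimal diagram lives in rows \<open>1, ..., m + 1\<close>, fills \<open>Y\<close>, and misses one
  row \<open>f c\<close> in each column \<open>c \<in> X\<close>.  If a column has at least as many cells in rows \<open>\<ge> s\<close> as a column to
  its right, for every \<open>s\<close>, then this remains true under all moves, so \<open>f\<close> is weakly increasing.
  Conversely every weakly increasing \<open>f\<close> is reached by lowering the rows one at a time.\<close>

section \<open>Minimal elements and invariants of Kohnert moves\<close>

definition column :: "diagram \<Rightarrow> nat \<Rightarrow> nat set" where
  "column D c = {r. (r, c) \<in> D}"

text \<open>The result of a move lies in \<open>KD D0\<close> and below \<open>D\<close>, while a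
  diagram fixed by all moves reaches only itself. Minimality thus becomes a condition on single
  moves.\<close>

lemma kohnert_minimal_eq_fixed:
  "kohnert_minimal D0 = {D \<in> KD D0. \<forall>r\<ge>1. kohnert_move r D = D}"
proof (intro set_eqI iffI)
  fix D assume D: "D \<in> kohnert_minimal D0"
  show "D \<in> {D \<in> KD D0. \<forall>r\<ge>1. kohnert_move r D = D}"
  proof (intro CollectI conjI allI impI)
    show "D \<in> KD D0" using D by (simp add: kohnert_minimal_def)
    fix r :: nat assume "1 \<le> r"
    then have "kohnert_step D (kohnert_move r D)" by (auto simp: kohnert_step_def)
    moreover from this have "kohnert_move r D \<in> KD D0"
      using \<open>D \<in> KD D0\<close> by (auto simp: KD_def)
    ultimately show "kohnert_move r D = D"
      using D by (auto simp: kohnert_minimal_def kohnert_le_def)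
  qed
next
  fix D assume D: "D \<in> {D \<in> KD D0. \<forall>r\<ge>1. kohnert_move r D = D}"
  have "E = D" if "kohnert_step\<^sup>*\<^sup>* D E" for E
    using that D by (induction rule: rtranclp_induct) (auto simp: kohnert_step_def)
  then show "D \<in> kohnert_minimal D0"
    using D by (auto simp: kohnert_minimal_def kohnert_le_def)
qed

lemma finite_row_columns: "is_diagram D \<Longrightarrow> finite (row_columns r D)"
  by (rule finite_subset[of _ "snd ` D"]) (force simp: row_columns_def, simp add: is_diagram_def)

lemma finite_column: "is_diagram D \<Longrightarrow> finite (column D c)"
  by (rule finite_subset[of _ "fst ` D"]) (force simp: column_def, simp add: is_diagram_def)

text \<open>Replaces the two maxima in the definition by the facts that characterise them;
  \<open>kohnert_move_eq\<close> goes the opposite way.\<close>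

lemma kohnert_move_cases [consumes 1, case_names fixed drop]:
  assumes "is_diagram D"
  obtains (fixed) "kohnert_move r D = D"
  | (drop) c r' where "(r, c) \<in> D" "\<And>c'. c < c' \<Longrightarrow> (r, c') \<notin> D" "1 \<le> r'" "r' < r" "(r', c) \<notin> D"
      "\<And>s. r' < s \<Longrightarrow> s < r \<Longrightarrow> (s, c) \<in> D"
      "kohnert_move r D = insert (r', c) (D - {(r, c)})"
proof (cases "row_columns r D = {} \<or> free_rows_below r (Max (row_columns r D)) D = {}")
  case True
  then show ?thesis using fixed by (auto simp: kohnert_move_def Let_def)
next
  case False
  define c where "c = Max (row_columns r D)"
  define r' where "r' = Max (free_rows_below r c D)"
  have fin: "finite (row_columns r D)" by (rule finite_row_columns[OF assms])
  have c: "(r, c) \<in> D"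
    using Max_in[OF fin] False by (auto simp: c_def row_columns_def)
  have fin2: "finite (free_rows_below r c D)"
    by (simp add: free_rows_below_def)
  then have r': "r' \<in> free_rows_below r c D"
    unfolding r'_def using False by (intro Max_in) (auto simp: c_def)
  show ?thesis
  proof (rule drop[OF c])
    show "(r, c') \<notin> D" if "c < c'" for c'
      using Max_ge[OF fin, folded c_def, of c'] that by (auto simp: row_columns_def)
    show "(s, c) \<in> D" if "r' < s" "s < r" for s
      using Max_ge[OF fin2, folded r'_def, of s] that r' by (auto simp: free_rows_below_def)
    show "kohnert_move r D = insert (r', c) (D - {(r, c)})"
      using False by (auto simp: kohnert_move_def Let_def c_def r'_def)
  qed (use r' in \<open>auto simp: free_rows_below_def\<close>)
qed

lemma kohnert_move_eq:
  assumes "is_diagram D" "(r, c) \<in> D" "\<And>c'. c < c' \<Longrightarrow> (r, c') \<notin> D"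
    and "1 \<le> r'" "r' < r" "(r', c) \<notin> D" "\<And>s. r' < s \<Longrightarrow> s < r \<Longrightarrow> (s, c) \<in> D"
  shows "kohnert_move r D = insert (r', c) (D - {(r, c)})"
proof -
  have "Max (row_columns r D) = c"
    using assms(2,3) by (intro Max_eqI finite_row_columns[OF assms(1)])
      (auto simp: row_columns_def not_less[symmetric])
  moreover have "Max (free_rows_below r c D) = r'"
    using assms(4-7) by (intro Max_eqI) (auto simp: free_rows_below_def not_less[symmetric])
  moreover have "row_columns r D \<noteq> {}" "free_rows_below r c D \<noteq> {}"
    using assms by (auto simp: row_columns_def free_rows_below_def)
  ultimately show ?thesis by (simp add: kohnert_move_def Let_def)
qed

text \<open>Idle moves are discharged here once and for all, so an invariant has to be checked only
  for a cell that really drops.\<close>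

lemma KD_induct [consumes 2, case_names base move]:
  assumes "D \<in> KD D0" "is_diagram D0"
    and "P D0"
    and "\<And>D r c r'. \<lbrakk>P D; is_diagram D; (r, c) \<in> D; \<And>c'. c < c' \<Longrightarrow> (r, c') \<notin> D; r' < r;
      (r', c) \<notin> D; \<And>s. r' < s \<Longrightarrow> s < r \<Longrightarrow> (s, c) \<in> D\<rbrakk> \<Longrightarrow> P (insert (r', c) (D - {(r, c)}))"
  shows "is_diagram D \<and> P D"
proof -
  from assms(1) have "kohnert_step\<^sup>*\<^sup>* D0 D" by (simp add: KD_def)
  then show ?thesis
  proof (induction rule: rtranclp_induct)
    case base
    then show ?case using assms(2,3) by simp
  next
    case (step D E)
    then obtain r where E: "E = kohnert_move r D" by (auto simp: kohnert_step_def)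
    have D: "is_diagram D" "P D" using step by auto
    have "P E"
      using D(1)
    proof (cases rule: kohnert_move_cases[where r = r])
      case fixed
      then show ?thesis using D E by simp
    next
      case (drop c r')
      show ?thesis unfolding E drop(7) by (rule assms(4)[OF D(2,1)]) (use drop in auto)
    qed
    then show ?case using is_diagram_kohnert_move[OF D(1)] E by simp
  qed
qed

lemma column_move:
  "column (insert (r', c) (D - {(r, c)})) d =
    (if d = c then insert r' (column D c - {r}) else column D d)"
  by (auto simp: column_def)

lemma is_diagram_KD: "D \<in> KD D0 \<Longrightarrow> is_diagram D0 \<Longrightarrow> is_diagram D"
  using KD_induct[of D D0 "\<lambda>_. True"] by blast

lemma card_column_KD:
  assumes "D \<in> KD D0" "is_diagram D0"
  shows "card (column D d) = card (column D0 d)"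
proof -
  have "is_diagram D \<and> card (column D d) = card (column D0 d)"
    using assms
  proof (induction rule: KD_induct)
    case (move D r c r')
    have "r \<in> column D c" "r' \<notin> column D c" using move by (auto simp: column_def)
    \<comment> \<open>Exchanging \<open>r\<close> for \<open>r'\<close> gives the cardinality
      \<open>Suc (card (column D c) - 1)\<close>, where truncated subtraction calls for
      positivity.\<close>
    moreover from this have "0 < card (column D c)"
      using finite_column[OF move(2)] by (auto simp: card_gt_0_iff)
    ultimately show ?case
      using move(1) finite_column[OF move(2)] by (auto simp: column_move)
  qed simp
  then show ?thesis by simp
qed

section \<open>Dominance between columns\<close>

text \<open>For finite sets listed from the top down: each entry of \<open>B\<close> has a
  counterpart in \<open>A\<close> at the same position that is at least as large. Upper counts make
  the effect of a single move easy to trace.\<close>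

definition dominates :: "nat set \<Rightarrow> nat set \<Rightarrow> bool" where
  "dominates A B \<longleftrightarrow> (\<forall>s. card (B \<inter> {s..}) \<le> card (A \<inter> {s..}))"

text \<open>Lowering an element never raises an upper count: for \<open>s \<le> r'\<close> the old
  and the new element are both counted, and for larger \<open>s\<close> the new one is not.\<close>

lemma dominates_lower_right:
  assumes "dominates A B" "finite B" "r \<in> B" "r' < r" "r' \<notin> B"
  shows "dominates A (insert r' (B - {r}))"
  unfolding dominates_def
proof
  fix s
  have "card (insert r' (B - {r}) \<inter> {s..}) \<le> card (B \<inter> {s..})"
  proof (cases "s \<le> r'")
    case True
    then have "insert r' (B - {r}) \<inter> {s..} = insert r' (B \<inter> {s..} - {r})" by auto
    moreover have "card \<dots> = card (B \<inter> {s..})"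
      using assms True card_Suc_Diff1[of "B \<inter> {s..}" r] by (simp add: card_insert_if)
    ultimately show ?thesis by simp
  next
    case False
    then show ?thesis using assms(2) by (intro card_mono) auto
  qed
  then show "card (insert r' (B - {r}) \<inter> {s..}) \<le> card (A \<inter> {s..})"
    using assms(1) le_trans unfolding dominates_def by blast
qed

text \<open>A left cell in row \<open>r\<close> may only drop when the right column has no cell in row \<open>r\<close>; this makes
  the counts above every row in \<open>(r', r]\<close> strictly larger on the left before the move.\<close>

lemma dominates_lower_left:
  assumes "dominates A B" "finite A" "finite B" "r \<in> A" "r \<notin> B" "r' < r" "r' \<notin> A" "{r'<..<r} \<subseteq> A"
  shows "dominates (insert r' (A - {r})) B"
  unfolding dominates_def
proof
  fix s
  consider "s \<le> r'" | "r' < s" "s \<le> r" | "r < s" by linarith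
  then show "card (B \<inter> {s..}) \<le> card (insert r' (A - {r}) \<inter> {s..})"
  proof cases
    case 1
    then have "insert r' (A - {r}) \<inter> {s..} = insert r' (A \<inter> {s..} - {r})" by auto
    moreover have "card \<dots> = card (A \<inter> {s..})"
      using assms 1 card_Suc_Diff1[of "A \<inter> {s..}" r] by (simp add: card_insert_if)
    ultimately show ?thesis using assms(1) by (simp add: dominates_def)
  next
    case 2
    \<comment> \<open>From \<open>s\<close> up to row \<open>r\<close>, the set \<open>B\<close> has
      at most \<open>r - s\<close> elements because it misses \<open>r\<close>; the lowered left set
      contains all of \<open>{s..<r}\<close>.\<close>
    have "card (B \<inter> {s..}) \<le> card ({s..<r} \<union> (B \<inter> {Suc r..}))"
      using assms(3,5) by (intro card_mono) (auto simp: not_less Suc_le_eq order_less_le)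
    also have "\<dots> \<le> (r - s) + card (B \<inter> {Suc r..})"
      using card_Un_le[of "{s..<r}" "B \<inter> {Suc r..}"] by simp
    also have "\<dots> \<le> (r - s) + card (A \<inter> {Suc r..})"
      using assms(1) by (simp add: dominates_def)
    also have "\<dots> = card ({s..<r} \<union> (A \<inter> {Suc r..}))"
      using assms(2) by (subst card_Un_disjoint) auto
    also have "{s..<r} \<union> (A \<inter> {Suc r..}) = insert r' (A - {r}) \<inter> {s..}"
      using 2 assms(8) by (auto simp: Suc_le_eq)
    finally show ?thesis .
  next
    case 3
    then have "insert r' (A - {r}) \<inter> {s..} = A \<inter> {s..}" using assms(6) by auto
    then show ?thesis using assms(1) by (simp add: dominates_def)
  qed
qed

lemma dominates_column_KD:
  assumes "D \<in> KD D0" "is_diagram D0" "a < b" "dominates (column D0 a) (column D0 b)"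
  shows "dominates (column D a) (column D b)"
proof -
  have "is_diagram D \<and> dominates (column D a) (column D b)"
    using assms(1,2)
  proof (induction rule: KD_induct)
    case base
    then show ?case by (rule assms(4))
  next
    case (move D r c r')
    have r: "r \<in> column D c" "r' \<notin> column D c" "{r'<..<r} \<subseteq> column D c"
      using move by (auto simp: column_def)
    have fin: "finite (column D x)" for x by (rule finite_column[OF move(2)])
    consider "c = a" | "c = b" | "c \<noteq> a" "c \<noteq> b" by blast
    then show ?case
    proof cases
      case 1
      \<comment> \<open>The dropping cell is the rightmost of its row, which supplies the hypothesis
        of \<open>dominates_lower_left\<close> about the right column.\<close>
      then have "r \<notin> column D b" using move(4) assms(3) by (simp add: column_def)
      then show ?thesis
        using dominates_lower_left[OF move(1) fin fin, of r r'] r move(5) 1 assms(3)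
        by (simp add: column_move)
    next
      case 2
      then show ?thesis
        using dominates_lower_right[OF move(1) fin, of r r'] r move(5) assms(3)
        by (simp add: column_move)
    next
      case 3
      then show ?thesis using move(1) by (simp add: column_move)
    qed
  qed
  then show ?thesis by simp
qed

section \<open>Existence and shape of minimal diagrams\<close>

text \<open>Every move that changes a diagram lowers the sum of its row numbers, so an element of
  \<open>KD D0\<close> with least sum is fixed by all moves.\<close>

lemma exists_kohnert_minimal:
  assumes "is_diagram D0"
  shows "kohnert_minimal D0 \<noteq> {}"
proof -
  define h where "h = (\<lambda>D :: diagram. sum fst D)"
  obtain D where D: "D \<in> KD D0" and least: "\<And>E. E \<in> KD D0 \<Longrightarrow> h D \<le> h E"
    using ex_has_least_nat[of "\<lambda>D. D \<in> KD D0" D0 h] by (auto simp: KD_def)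
  have dD: "is_diagram D" by (rule is_diagram_KD[OF D assms])
  have "kohnert_move r D = D" if "1 \<le> r" for r
    using dD
  proof (cases rule: kohnert_move_cases[where r = r])
    case (drop c r')
    have "finite D" using dD by (simp add: is_diagram_def)
    have "h (kohnert_move r D) = r' + h (D - {(r, c)})"
      using \<open>finite D\<close> drop by (simp add: h_def)
    also have "\<dots> < h D"
      using sum.remove[OF \<open>finite D\<close> drop(1), of fst] drop(4) by (simp add: h_def)
    finally have "\<not> kohnert_move r D \<in> KD D0" using least leD by blast
    moreover have "kohnert_move r D \<in> KD D0"
    proof -
      have "kohnert_step D (kohnert_move r D)" using that by (auto simp: kohnert_step_def)
      then show ?thesis
        using D unfolding KD_def by (blast intro: rtranclp.rtrancl_into_rtrancl)
    qed
    ultimately show ?thesis by blast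
  qed simp
  then show ?thesis using D by (auto simp: kohnert_minimal_eq_fixed)
qed

text \<open>The column of the rightmost cell of row \<open>r\<close> serves: the move at that row is
  idle, so no position below this cell is free.\<close>

lemma minimal_cell_below_full_column:
  assumes D: "D \<in> kohnert_minimal D0" and "is_diagram D0" and cell: "(r, c) \<in> D"
  obtains c' where "c \<le> c'" "{1..r} \<subseteq> column D c'"
proof -
  have "D \<in> KD D0" using D by (simp add: kohnert_minimal_def)
  then have dD: "is_diagram D" using is_diagram_KD assms(2) by blast
  define c' where "c' = Max (row_columns r D)"
  have fin: "finite (row_columns r D)" by (rule finite_row_columns[OF dD])
  have c: "c \<in> row_columns r D" using cell by (simp add: row_columns_def)
  have c': "(r, c') \<in> D"
    using Max_in[OF fin] c by (auto simp: c'_def row_columns_def)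
  have "kohnert_move r D = D"
    using D dD cell by (auto simp: kohnert_minimal_eq_fixed is_diagram_def)
  then have "free_rows_below r c' D = {}"
    using c c' Max_in[of "free_rows_below r c' D"]
    by (force simp: kohnert_move_def Let_def c'_def[symmetric] free_rows_below_def
        split: if_splits)
  then have "{1..r} \<subseteq> column D c'"
    using c' by (force simp: free_rows_below_def column_def le_less)
  moreover have "c \<le> c'" unfolding c'_def by (rule Max_ge[OF fin c])
  ultimately show ?thesis using that by blast
qed

section \<open>Counting weakly increasing maps\<close>

text \<open>Maps are extensional, so that they are determined by their values on \<open>X\<close>
  and can be counted.\<close>

definition mono_maps :: "nat set \<Rightarrow> nat \<Rightarrow> (nat \<Rightarrow> nat) set" where
  "mono_maps X k = {f \<in> X \<rightarrow>\<^sub>E {1..k}. mono_on X f}"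

lemma finite_mono_maps: "finite X \<Longrightarrow> finite (mono_maps X k)"
  unfolding mono_maps_def by (rule finite_subset[OF _ finite_PiE[of X "\<lambda>_. {1..k}"]]) auto

text \<open>Sending the largest point to the largest value puts no condition on the other values;
  setting \<open>b\<close> to \<open>k\<close> and resetting it to \<open>undefined\<close> are
  mutually inverse.\<close>

lemma card_mono_maps_top:
  assumes "\<And>x. x \<in> X \<Longrightarrow> x < b" "1 \<le> k"
  shows "card {f \<in> mono_maps (insert b X) k. f b = k} = card (mono_maps X k)"
proof -
  have b: "b \<notin> X" using assms(1) by auto
  have "bij_betw (\<lambda>f. f(b := k)) (mono_maps X k) {f \<in> mono_maps (insert b X) k. f b = k}"
  proof (rule bij_betw_byWitness[where f' = "\<lambda>f. f(b := undefined)"])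
    show "\<forall>f\<in>mono_maps X k. f(b := k, b := undefined) = f"
      using b by (auto simp: mono_maps_def PiE_def extensional_def fun_upd_def)
    show "\<forall>f\<in>{f \<in> mono_maps (insert b X) k. f b = k}. f(b := undefined, b := k) = f"
      by (auto simp: fun_upd_def)
    show "(\<lambda>f. f(b := k)) ` mono_maps X k \<subseteq> {f \<in> mono_maps (insert b X) k. f b = k}"
    proof (rule image_subsetI)
      fix f assume f: "f \<in> mono_maps X k"
      have "f(b := k) \<in> insert b X \<rightarrow>\<^sub>E {1..k}"
        using f assms(2) by (auto simp: mono_maps_def PiE_def extensional_def)
      moreover have "mono_on (insert b X) (f(b := k))"
      proof (rule mono_onI)
        fix x y assume xy: "x \<in> insert b X" "y \<in> insert b X" "x \<le> y"
        show "(f(b := k)) x \<le> (f(b := k)) y"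
        proof (cases "y = b")
          case True
          then show ?thesis using f xy by (auto simp: mono_maps_def)
        next
          case False
          then have "y \<in> X" "x \<in> X" "x \<noteq> b" using xy assms(1) by force+
          then show ?thesis using False f xy(3) by (auto simp: mono_maps_def dest: mono_onD)
        qed
      qed
      ultimately show "f(b := k) \<in> {f \<in> mono_maps (insert b X) k. f b = k}"
        by (simp add: mono_maps_def)
    qed
    show "(\<lambda>f. f(b := undefined)) ` {f \<in> mono_maps (insert b X) k. f b = k} \<subseteq> mono_maps X k"
    proof (rule image_subsetI)
      fix f assume "f \<in> {f \<in> mono_maps (insert b X) k. f b = k}"
      then have f: "f \<in> mono_maps (insert b X) k" by simp
      have "f(b := undefined) \<in> X \<rightarrow>\<^sub>E {1..k}"
        using f b by (auto simp: mono_maps_def PiE_def extensional_def)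
      moreover have "mono_on X (f(b := undefined))"
        using f b by (auto simp: mono_maps_def mono_on_def)
      ultimately show "f(b := undefined) \<in> mono_maps X k" by (simp add: mono_maps_def)
    qed
  qed
  then show ?thesis by (simp add: bij_betw_same_card)
qed

text \<open>Such maps correspond to multisets of size \<open>card X\<close> over \<open>k\<close>
  values. Splitting by whether the greatest point takes the greatest value reproduces Pascal's
  rule.\<close>

lemma card_mono_maps:
  assumes "finite X"
  shows "card (mono_maps X k) = (card X + k - 1) choose card X"
  using assms
proof (induction X arbitrary: k rule: finite_linorder_max_induct)
  case empty
  have "mono_maps {} k = {\<lambda>_. undefined}" by (auto simp: mono_maps_def mono_on_def)
  then show ?case by simp
next
  case (insert b X)
  have b: "b \<notin> X" using insert by auto
  show ?case
  proof (induction k)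
    case 0
    \<comment> \<open>Without values there is no map, and truncated subtraction turns the right side
      into \<open>card X choose Suc (card X)\<close>, which is 0 as well.\<close>
    have "mono_maps (insert b X) 0 = {}" by (auto simp: mono_maps_def)
    then show ?case using insert b by simp
  next
    case (Suc k)
    let ?M = "mono_maps (insert b X)"
    have split: "?M (Suc k) = {f \<in> ?M (Suc k). f b = Suc k} \<union> ?M k"
    proof (intro set_eqI iffI)
      fix f assume f: "f \<in> ?M (Suc k)"
      show "f \<in> {f \<in> ?M (Suc k). f b = Suc k} \<union> ?M k"
      proof (cases "f b = Suc k")
        case True
        then show ?thesis using f by simp
      next
        case False
        have "f \<in> insert b X \<rightarrow>\<^sub>E {1..Suc k}" "mono_on (insert b X) f"
          using f by (auto simp: mono_maps_def)
        moreover from this have "f b \<le> k" using False by force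
        \<comment> \<open>Since \<open>b\<close> is the greatest point, a bound on
          \<open>f b\<close> bounds all values.\<close>
        moreover from calculation have "f x \<le> k" if "x \<in> X" for x
          using that insert(2) mono_onD[of "insert b X" f x b] by (force simp: less_imp_le)
        ultimately have "f \<in> ?M k"
          unfolding mono_maps_def by (auto simp: PiE_iff)
        then show ?thesis by simp
      qed
    qed (auto simp: mono_maps_def PiE_iff)
    have "card (?M (Suc k)) = card {f \<in> ?M (Suc k). f b = Suc k} + card (?M k)"
    proof -
      have "{f \<in> ?M (Suc k). f b = Suc k} \<inter> ?M k = {}" by (auto simp: mono_maps_def PiE_iff)
      moreover have "finite (?M j)" for j using insert(1) by (simp add: finite_mono_maps)
      ultimately show ?thesis by (subst split, subst card_Un_disjoint) auto
    qed
    \<comment> \<open>The first summand comes from the induction on \<open>X\<close>, the second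
      from the induction on \<open>k\<close>.\<close>
    also have "\<dots> = ((card X + k) choose card X) + ((card X + k) choose Suc (card X))"
      using insert b Suc by (subst card_mono_maps_top) auto
    finally show ?case using insert b by simp
  qed
qed

section \<open>Striped diagrams\<close>

text \<open>With \<open>X\<close> and \<open>Y\<close> left open, one argument serves both checkered
  diagrams of side \<open>2 * m + 1\<close>.\<close>

definition striped_row :: "nat \<Rightarrow> nat set \<Rightarrow> nat set \<Rightarrow> nat \<Rightarrow> nat set" where
  "striped_row m X Y r =
    (if r = 0 \<or> 2 * m + 1 < r then {} else if even r then X else Y)"

text \<open>Describing a diagram row by row turns the lowering of a row, or of a part of it, into a
  function update.\<close>

definition of_rows :: "(nat \<Rightarrow> nat set) \<Rightarrow> diagram" where
  "of_rows R = {(r, c). c \<in> R r}"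

abbreviation striped :: "nat \<Rightarrow> nat set \<Rightarrow> nat set \<Rightarrow> diagram" where
  "striped m X Y \<equiv> of_rows (striped_row m X Y)"

definition punctured_row :: "nat \<Rightarrow> nat set \<Rightarrow> nat set \<Rightarrow> (nat \<Rightarrow> nat) \<Rightarrow> nat \<Rightarrow> nat set" where
  "punctured_row m X Y f r = (if r = 0 \<or> m + 1 < r then {} else Y \<union> {c \<in> X. f c \<noteq> r})"

abbreviation punctured :: "nat \<Rightarrow> nat set \<Rightarrow> nat set \<Rightarrow> (nat \<Rightarrow> nat) \<Rightarrow> diagram" where
  "punctured m X Y f \<equiv> of_rows (punctured_row m X Y f)"

section \<open>Moving whole rows down\<close>

lemma is_diagram_move_cell:
  assumes "is_diagram D" "(r, c) \<in> D" "1 \<le> r'"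
  shows "is_diagram (insert (r', c) (D - {(r, c)}))"
  using assms by (auto simp: is_diagram_def)

text \<open>As \<open>A\<close> is a final segment of row \<open>Suc p\<close>, its cells can drop
  from right to left: each is rightmost when its turn comes and has a free place directly
  below.\<close>

lemma reachable_drop:
  assumes "is_diagram (of_rows R)" "finite A" "A \<subseteq> R (Suc p)" "1 \<le> p"
    and "\<And>a b. a \<in> A \<Longrightarrow> b \<in> R (Suc p) - A \<Longrightarrow> b < a" "R p \<inter> A = {}"
  shows "kohnert_step\<^sup>*\<^sup>* (of_rows R) (of_rows (R(p := R p \<union> A, Suc p := R (Suc p) - A)))
    \<and> is_diagram (of_rows (R(p := R p \<union> A, Suc p := R (Suc p) - A)))"
  using assms(2,3,5,6)
\<comment> \<open>Elements are added in decreasing order, so all of \<open>A\<close> has dropped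
  before the smaller \<open>b\<close> is treated.\<close>
proof (induction A rule: finite_linorder_min_induct)
  case empty
  then show ?case using assms(1) by (simp add: fun_upd_idem)
next
  case (insert b A)
  let ?D = "of_rows (R(p := R p \<union> A, Suc p := R (Suc p) - A))"
  have IH: "kohnert_step\<^sup>*\<^sup>* (of_rows R) ?D" "is_diagram ?D"
  proof -
    have "kohnert_step\<^sup>*\<^sup>* (of_rows R) ?D \<and> is_diagram ?D"
    proof (rule insert.IH)
      show "x < a" if "a \<in> A" "x \<in> R (Suc p) - A" for a x
        using that insert.hyps(2) insert.prems(2)[of a x] by (cases "x = b") auto
    qed (use insert.prems in auto)
    then show "kohnert_step\<^sup>*\<^sup>* (of_rows R) ?D" "is_diagram ?D" by auto
  qed
  have b: "b \<in> R (Suc p)" "b \<notin> R p" "b \<notin> A" using insert.prems insert.hyps by auto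
  have cell: "(Suc p, b) \<in> ?D" using b by (simp add: of_rows_def)
  have move: "kohnert_move (Suc p) ?D = insert (p, b) (?D - {(Suc p, b)})"
  proof (rule kohnert_move_eq[OF IH(2) cell])
    show "(Suc p, c') \<notin> ?D" if "b < c'" for c'
      using that insert.prems(2)[of b c'] by (auto simp: of_rows_def)
  qed (use b assms(4) in \<open>auto simp: of_rows_def\<close>)
  have eq: "insert (p, b) (?D - {(Suc p, b)}) =
      of_rows (R(p := R p \<union> insert b A, Suc p := R (Suc p) - insert b A))"
    by (auto simp: of_rows_def split: if_splits)
  have step: "kohnert_step ?D (kohnert_move (Suc p) ?D)"
    by (auto simp: kohnert_step_def)
  have s: "kohnert_step ?D (of_rows (R(p := R p \<union> insert b A, Suc p := R (Suc p) - insert b A)))"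
    using step unfolding move eq .
  have d: "is_diagram (of_rows (R(p := R p \<union> insert b A, Suc p := R (Suc p) - insert b A)))"
    using is_diagram_move_cell[OF IH(2) cell assms(4)] unfolding eq .
  have s2: "kohnert_step\<^sup>*\<^sup>* (of_rows R) (of_rows (R(p := R p \<union> insert b A, Suc p := R (Suc p) - insert b A)))"
    using IH(1) s by (rule rtranclp.rtrancl_into_rtrancl)
  show ?case
    using s2 d ..
qed

text \<open>The row sinks one step at a time through the empty rows; disjointness lets it join row
  \<open>p\<close> in the last step.\<close>

lemma reachable_lower_row:
  assumes "is_diagram (of_rows R)" "p < q" "1 \<le> p" "R p \<inter> R q = {}"
    and "\<And>s. p < s \<Longrightarrow> s < q \<Longrightarrow> R s = {}"
  shows "kohnert_step\<^sup>*\<^sup>* (of_rows R) (of_rows (R(p := R p \<union> R q, q := {})))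
    \<and> is_diagram (of_rows (R(p := R p \<union> R q, q := {})))"
  using assms
proof (induction "q - p" arbitrary: q R)
  case 0
  then show ?case by simp
next
  case (Suc d)
  obtain q' where q: "q = Suc q'" "p \<le> q'" using Suc.prems by (cases q) auto
  have fin: "finite (R q)"
    by (rule finite_subset[OF _ finite_row_columns[OF Suc.prems(1), of q]])
      (auto simp: row_columns_def of_rows_def)
  show ?case
  proof (cases "p = q'")
    case True
    show ?thesis
      using reachable_drop[OF Suc.prems(1) fin, of p] Suc.prems q True by simp
  next
    case False
    then have empty: "R q' = {}" using Suc.prems(5)[of q'] q by auto
    let ?R = "R(q' := R q, q := {})"
    have 1: "kohnert_step\<^sup>*\<^sup>* (of_rows R) (of_rows ?R) \<and> is_diagram (of_rows ?R)"
      using reachable_drop[OF Suc.prems(1) fin, of q'] Suc.prems q empty by simp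
    have "kohnert_step\<^sup>*\<^sup>* (of_rows ?R) (of_rows (?R(p := ?R p \<union> ?R q', q' := {})))
      \<and> is_diagram (of_rows (?R(p := ?R p \<union> ?R q', q' := {})))"
      using Suc False q 1 by (intro Suc.hyps(1)) auto
    moreover have "?R(p := ?R p \<union> ?R q', q' := {}) = R(p := R p \<union> R q, q := {})"
      using False q empty by (auto simp: fun_eq_iff)
    ultimately show ?thesis using 1 by (metis rtranclp_trans)
  qed
qed

text \<open>Stage \<open>k\<close> on the way from \<open>striped\<close> to \<open>punctured\<close>: the lowest \<open>2k + 1\<close> rows have been compressed
  into \<open>k + 1\<close> rows, with the holes at height \<open>min (f c) (k + 1)\<close>.  To pass to stage \<open>k + 1\<close>, the
  \<open>X\<close>-row \<open>2k + 2\<close> comes down to row \<open>k + 2\<close>, the cells with \<open>f c \<ge> k + 2\<close>, a final segment of that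
  row, drop one step further into their holes, and then the \<open>Y\<close>-row \<open>2k + 3\<close> comes down.\<close>

definition stage_row where
  "stage_row m X Y f k r =
    (if r \<le> k + 1 then punctured_row k X Y (\<lambda>c. min (f c) (k + 1)) r
     else if r < 2 * k + 2 then {} else striped_row m X Y r)"

lemma is_diagram_of_rows:
  assumes "finite X" "0 \<notin> X" "R 0 = {}" "\<And>r. R r \<subseteq> X" "\<And>r. k < r \<Longrightarrow> R r = {}"
  shows "is_diagram (of_rows R)"
proof -
  have "of_rows R \<subseteq> {..k} \<times> X" using assms(4,5) by (force simp: of_rows_def not_le[symmetric])
  then have "finite (of_rows R)" using assms(1) finite_subset by blast
  moreover have "1 \<le> r \<and> 1 \<le> c" if "(r, c) \<in> of_rows R" for r c
    using that assms(2,3,4) by (cases r; cases c) (auto simp: of_rows_def)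
  ultimately show ?thesis by (auto simp: is_diagram_def)
qed

lemma reachable_next_stage:
  assumes "finite X" "finite Y" "X \<inter> Y = {}" "0 \<notin> X" "0 \<notin> Y" "k < m"
    and mono: "mono_on X f"
  shows "kohnert_step\<^sup>*\<^sup>* (of_rows (stage_row m X Y f k)) (of_rows (stage_row m X Y f (Suc k)))"
proof -
  define S where "S = stage_row m X Y f k"
  \<comment> \<open>\<open>R1\<close>, \<open>R2\<close> and \<open>R3\<close> describe the diagram
    after lowering the \<open>X\<close>-row, after dropping its final segment \<open>A\<close>, and
    after lowering the \<open>Y\<close>-row.\<close>
  define R1 where "R1 = (\<lambda>r. if r = k + 2 then X else if k + 2 < r \<and> r \<le> 2 * k + 2 then {} else S r)"
  \<comment> \<open>At stage \<open>k\<close> the columns with \<open>f c \<ge> k + 1\<close> have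
    their hole in row \<open>k + 1\<close>. Dropping \<open>A\<close> moves its holes up to row
    \<open>k + 2\<close>; columns with \<open>f c = k + 1\<close> keep theirs.\<close>
  define A where "A = {c \<in> X. k + 2 \<le> f c}"
  define R2 where "R2 = R1(k + 1 := R1 (k + 1) \<union> A, k + 2 := X - A)"
  define R3 where "R3 = R2(k + 2 := R2 (k + 2) \<union> Y, 2 * k + 3 := {})"
  have S: "is_diagram (of_rows S)"
    by (rule is_diagram_of_rows[of "X \<union> Y" _ "2 * m + 1"])
      (use assms in \<open>auto simp: S_def stage_row_def punctured_row_def striped_row_def\<close>)
  have 1: "kohnert_step\<^sup>*\<^sup>* (of_rows S) (of_rows R1) \<and> is_diagram (of_rows R1)"
  \<comment> \<open>For \<open>k = 0\<close> the \<open>X\<close>-row already stands in row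
    \<open>k + 2\<close>.\<close>
  proof (cases "k = 0")
    case True
    then have "R1 = S"
      using assms(6) by (auto simp: fun_eq_iff R1_def S_def stage_row_def striped_row_def)
    then show ?thesis using S by simp
  next
    case False
    have "R1 = S(k + 2 := S (k + 2) \<union> S (2 * k + 2), 2 * k + 2 := {})"
      using False assms(6)
      by (auto simp: fun_eq_iff R1_def S_def stage_row_def striped_row_def)
    then show ?thesis
      using reachable_lower_row[OF S, of "k + 2" "2 * k + 2"] False
      by (simp add: S_def stage_row_def)
  qed
  have R1: "R1 (Suc (k + 1)) = X" "R1 (k + 1) = Y \<union> {c \<in> X. min (f c) (k + 1) \<noteq> k + 1}"
    by (auto simp: R1_def S_def stage_row_def punctured_row_def)
  have 2: "kohnert_step\<^sup>*\<^sup>* (of_rows R1) (of_rows R2) \<and> is_diagram (of_rows R2)"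
  proof -
    \<comment> \<open>Monotonicity of \<open>f\<close> makes \<open>A\<close> a final segment of
      \<open>X\<close>.\<close>
    have "b < a" if "a \<in> A" "b \<in> X - A" for a b
      using that mono_onD[OF mono, of a b] by (force simp: A_def not_less[symmetric])
    then show ?thesis
      using reachable_drop[of R1 A "k + 1"] 1 R1 assms(1,3)
      by (fastforce simp: R2_def A_def)
  qed
  have 3: "kohnert_step\<^sup>*\<^sup>* (of_rows R2) (of_rows R3)"
  proof -
    have "R2 (2 * k + 3) = Y"
      using assms(6) by (simp add: R2_def R1_def S_def stage_row_def striped_row_def)
    then show ?thesis
      using reachable_lower_row[of R2 "k + 2" "2 * k + 3"] 2 assms(3)
      by (auto simp: R3_def R2_def R1_def)
  qed
  have "R3 = stage_row m X Y f (Suc k)"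
  proof
    fix r
    consider "r < k + 1" | "r = k + 1" | "r = k + 2" | "k + 2 < r" "r < 2 * k + 3"
      | "r = 2 * k + 3" | "2 * k + 3 < r" by linarith
    then show "R3 r = stage_row m X Y f (Suc k) r"
      by cases (use assms(6) in \<open>auto simp: R3_def R2_def R1_def S_def A_def stage_row_def
          striped_row_def punctured_row_def\<close>)
  qed
  then show ?thesis using 1 2 3 unfolding S_def by (metis rtranclp_trans)
qed

lemma punctured_in_KD:
  assumes "finite X" "finite Y" "X \<inter> Y = {}" "0 \<notin> X" "0 \<notin> Y"
    and f: "f \<in> mono_maps X (Suc m)"
  shows "punctured m X Y f \<in> KD (striped m X Y)"
proof -
  have range: "1 \<le> f c" "f c \<le> Suc m" if "c \<in> X" for c
    using f that by (auto simp: mono_maps_def)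
  have mono: "mono_on X f" using f by (simp add: mono_maps_def)
  have "kohnert_step\<^sup>*\<^sup>* (of_rows (stage_row m X Y f 0)) (of_rows (stage_row m X Y f k))" if "k \<le> m" for k
    using that
  proof (induction k)
    case (Suc k)
    then show ?case
      using reachable_next_stage[OF assms(1-5) _ mono, of k m] by (auto intro: rtranclp_trans)
  qed simp
  then have "kohnert_step\<^sup>*\<^sup>* (of_rows (stage_row m X Y f 0)) (of_rows (stage_row m X Y f m))" by simp
  \<comment> \<open>Because \<open>f c \<ge> 1\<close>, all holes of stage 0 are in row 1, which
    therefore consists of \<open>Y\<close> alone.\<close>
  moreover have "stage_row m X Y f 0 = striped_row m X Y"
    using range by (fastforce simp: fun_eq_iff stage_row_def striped_row_def punctured_row_def)
  \<comment> \<open>Because \<open>f c \<le> Suc m\<close>, the minimum with \<open>m + 1\<close> is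
    \<open>f c\<close> itself, and no striped rows are left above.\<close>
  moreover have "stage_row m X Y f m = punctured_row m X Y f"
    using range by (force simp: fun_eq_iff stage_row_def striped_row_def punctured_row_def)
  ultimately show ?thesis by (simp add: KD_def)
qed

section \<open>Minimal diagrams below a striped diagram\<close>

lemma card_odd_rows: "card {r. odd r \<and> 1 \<le> r \<and> r \<le> 2 * m + 1} = Suc m"
  and card_odd_rows_even: "card {r. odd r \<and> 1 \<le> r \<and> r \<le> 2 * m} = m"
  and card_even_rows: "card {r. even r \<and> 1 \<le> r \<and> r \<le> 2 * m} = m"
  for m :: nat
proof -
  have "{r. odd r \<and> 1 \<le> r \<and> r \<le> 2 * m + 1} = (\<lambda>i. 2 * i + 1) ` {..m}"
    by (auto elim!: oddE)
  then show "card {r. odd r \<and> 1 \<le> r \<and> r \<le> 2 * m + 1} = Suc m"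
    by (simp add: card_image inj_on_def)
  have "{r. odd r \<and> 1 \<le> r \<and> r \<le> 2 * m} = (\<lambda>i. 2 * i + 1) ` {..<m}"
    by (auto elim!: oddE)
  then show "card {r. odd r \<and> 1 \<le> r \<and> r \<le> 2 * m} = m"
    by (simp add: card_image inj_on_def)
  have "{r. even r \<and> 1 \<le> r \<and> r \<le> 2 * m} = (\<lambda>i. 2 * i) ` {1..m}"
    by (auto elim!: evenE)
  then show "card {r. even r \<and> 1 \<le> r \<and> r \<le> 2 * m} = m"
    by (simp add: card_image inj_on_def)
qed

lemma column_punctured:
  assumes "X \<inter> Y = {}"
  shows "column (punctured m X Y f) c =
    (if c \<in> Y then {1..Suc m} else if c \<in> X then {1..Suc m} - {f c} else {})"
  using assms by (auto simp: column_def of_rows_def punctured_row_def split: if_splits)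

text \<open>The count from \<open>s = a\<close> decides: if \<open>b < a\<close>, the right set
  contains all of \<open>{a..k}\<close>, whereas the left one misses \<open>a\<close>.\<close>

lemma dominates_punctured_imp_le:
  assumes "dominates ({1..k} - {a}) ({1..k} - {b})" "a \<in> {1..k}" "b \<in> {1..k}"
  shows "a \<le> b"
proof (rule ccontr)
  assume "\<not> a \<le> b"
  then have "({1..k} - {a}) \<inter> {a..} = {Suc a..k}" "({1..k} - {b}) \<inter> {a..} = {a..k}"
    using assms(2) by auto
  then have "card {a..k} \<le> card {Suc a..k}"
    using assms(1)[unfolded dominates_def, rule_format, of a] by simp
  then show False using assms(2) by auto
qed

lemma card_Suc_subset_missing_one:
  assumes "A \<subseteq> {1..Suc m}" "card A = m"
  obtains a where "a \<in> {1..Suc m}" "A = {1..Suc m} - {a}"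
proof -
  have "card ({1..Suc m} - A) = 1"
    using assms card_Diff_subset[of A "{1..Suc m}"] finite_subset[OF assms(1)] by simp
  then obtain a where "{1..Suc m} - A = {a}" using card_1_singletonE by blast
  then show ?thesis using assms(1) that[of a] by blast
qed

text \<open>If \<open>c \<in> X\<close> lies to the right of all of \<open>Y\<close>, minimality forces its column to be bottom-justified,
  so its hole is the top row.\<close>

lemma kohnert_minimal_striped:
  assumes "finite X" "finite Y" "X \<inter> Y = {}" "0 \<notin> X" "0 \<notin> Y"
  shows "kohnert_minimal (striped m X Y) =
    punctured m X Y ` {f \<in> mono_maps X (Suc m). \<forall>c\<in>X. (\<forall>y\<in>Y. y < c) \<longrightarrow> f c = Suc m}"
    (is "_ = _ ` ?F")
proof (intro set_eqI iffI)
  let ?D0 = "striped m X Y"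
  have D0: "is_diagram ?D0"
    by (rule is_diagram_of_rows[of "X \<union> Y" _ "2 * m + 1"])
      (use assms in \<open>auto simp: striped_row_def\<close>)
  have col0: "column ?D0 c = (if c \<in> Y then {r. odd r \<and> 1 \<le> r \<and> r \<le> 2 * m + 1}
      else if c \<in> X then {r. even r \<and> 1 \<le> r \<and> r \<le> 2 * m} else {})" for c
    using assms(3) by (auto simp: column_def of_rows_def striped_row_def Suc_le_eq le_less
      less_Suc_eq split: if_splits)
  fix D assume D: "D \<in> kohnert_minimal ?D0"
  have KD: "D \<in> KD ?D0" using D by (simp add: kohnert_minimal_def)
  have dD: "is_diagram D" by (rule is_diagram_KD[OF KD D0])
  have card_col: "card (column D c) = (if c \<in> Y then Suc m else if c \<in> X then m else 0)" for c
    unfolding card_column_KD[OF KD D0] col0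
    using card_odd_rows[of m] card_even_rows[of m] by simp
  have fin: "finite (column D c)" for c by (rule finite_column[OF dD])
  \<comment> \<open>A cell in row \<open>r\<close> needs a column weakly to its right with at least
    \<open>r\<close> cells. This confines everything to rows up to \<open>Suc m\<close> and later
    forces the holes to the right of \<open>Y\<close>.\<close>
  have ex: "\<exists>c'\<ge>c. r \<le> card (column D c')" if rc: "r \<in> column D c" for r c
  proof -
    obtain c' where "c \<le> c'" "{1..r} \<subseteq> column D c'"
      using minimal_cell_below_full_column[OF D D0, of r c] rc unfolding column_def by blast
    then show ?thesis using card_mono[OF fin, of "{1..r}" c'] by auto
  qed
  have pos: "1 \<le> r" if "r \<in> column D c" for r c
    using that dD by (auto simp: column_def is_diagram_def)
  have sub: "column D c \<subseteq> {1..Suc m}" for c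
  proof
    fix r assume r: "r \<in> column D c"
    then obtain c' where "r \<le> card (column D c')" using ex by blast
    then show "r \<in> {1..Suc m}" using pos[OF r] by (auto simp: card_col split: if_splits)
  qed
  have colY: "column D c = {1..Suc m}" if "c \<in> Y" for c
    using that card_col[of c] sub[of c] by (intro card_subset_eq) auto
  have "\<exists>a. a \<in> {1..Suc m} \<and> column D c = {1..Suc m} - {a}" if "c \<in> X" for c
  proof -
    have "card (column D c) = m" using card_col[of c] that assms(3) by auto
    then show ?thesis using card_Suc_subset_missing_one[OF sub] by metis
  qed
  then obtain g where g: "\<And>c. c \<in> X \<Longrightarrow> g c \<in> {1..Suc m} \<and> column D c = {1..Suc m} - {g c}"
    by metis
  \<comment> \<open>Restriction makes the map extensional, as \<open>mono_maps\<close>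
    demands.\<close>
  define f where "f = restrict g X"
  have f: "f c \<in> {1..Suc m}" "column D c = {1..Suc m} - {f c}" if "c \<in> X" for c
    using g[OF that] that by (auto simp: f_def)
  have "f a \<le> f b" if "a \<in> X" "b \<in> X" "a \<le> b" for a b
  proof (cases "a = b")
    case False
    \<comment> \<open>Columns in \<open>X\<close> start out equal, so dominance holds initially and
      persists.\<close>
    have "column ?D0 a = column ?D0 b" using that assms(3) by (auto simp: col0)
    then have "dominates (column D a) (column D b)"
      using False that by (intro dominates_column_KD[OF KD D0]) (auto simp: dominates_def)
    then show ?thesis using f that dominates_punctured_imp_le by metis
  qed simp
  then have "f \<in> mono_maps X (Suc m)"
    using f(1) by (auto simp: mono_maps_def f_def mono_on_def)
  moreover have "f c = Suc m" if "c \<in> X" "\<forall>y\<in>Y. y < c" for c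
  proof (rule ccontr)
    assume "f c \<noteq> Suc m"
    then have "Suc m \<in> column D c" using f[OF that(1)] by auto
    then obtain c' where "c \<le> c'" "Suc m \<le> card (column D c')" using ex by blast
    then show False using that by (auto simp: card_col split: if_splits)
  qed
  moreover have "D = punctured m X Y f"
  proof -
    have "column D c = column (punctured m X Y f) c" for c
      using colY[of c] f(2)[of c] card_col[of c] fin[of c]
      by (auto simp: column_punctured[OF assms(3)])
    then show ?thesis by (auto simp: column_def set_eq_iff)
  qed
  ultimately show "D \<in> punctured m X Y ` ?F" by blast
next
  fix D assume "D \<in> punctured m X Y ` ?F"
  then obtain f where f: "f \<in> mono_maps X (Suc m)" "\<And>c. c \<in> X \<Longrightarrow> \<forall>y\<in>Y. y < c \<Longrightarrow> f c = Suc m"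
    and D: "D = punctured m X Y f" by blast
  have dD: "is_diagram D"
    unfolding D by (rule is_diagram_of_rows[of "X \<union> Y" _ "Suc m"])
      (use assms in \<open>auto simp: punctured_row_def\<close>)
  have "kohnert_move r D = D" for r
    using dD
  proof (cases rule: kohnert_move_cases[where r = r])
    case (drop c r')
    have rc: "r \<in> column D c" "r' \<notin> column D c" using drop by (auto simp: column_def)
    have r: "r \<le> Suc m" using rc(1) by (auto simp: D column_punctured[OF assms(3)] split: if_splits)
    have "c \<notin> Y" using rc drop(3,4) by (auto simp: D column_punctured[OF assms(3)])
    then have "c \<in> X" using rc(1) by (auto simp: D column_punctured[OF assms(3)] split: if_splits)
    \<comment> \<open>Columns in \<open>Y\<close> are filled up to row \<open>Suc m\<close>, so one
      to the right of \<open>c\<close> would have a cell in row \<open>r\<close>, beyond the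
      rightmost one.\<close>
    have "y < c" if "y \<in> Y" for y
    proof (rule ccontr)
      assume "\<not> y < c"
      then have "c < y" using \<open>c \<notin> Y\<close> that by (metis linorder_neqE_nat)
      then have "r \<notin> column D y" using drop(2) by (simp add: column_def)
      then show False using that r drop(3,4) by (auto simp: D column_punctured[OF assms(3)])
    qed
    then have "column D c = {1..Suc m} - {Suc m}"
      using f(2) \<open>c \<in> X\<close> \<open>c \<notin> Y\<close> by (simp add: D column_punctured[OF assms(3)])
    then show ?thesis using rc drop(3,4) by auto
  qed simp
  then show "D \<in> kohnert_minimal (striped m X Y)"
    using punctured_in_KD[OF assms f(1)] by (simp add: kohnert_minimal_eq_fixed D)
qed

text \<open>The value \<open>f c\<close> can be read off as the only row of
  \<open>{1..Suc m}\<close> missing from column \<open>c\<close>.\<close>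

lemma inj_on_punctured:
  assumes "X \<inter> Y = {}"
  shows "inj_on (punctured m X Y) (mono_maps X (Suc m))"
proof (rule inj_onI)
  fix f g assume fg: "f \<in> mono_maps X (Suc m)" "g \<in> mono_maps X (Suc m)"
    and eq: "punctured m X Y f = punctured m X Y g"
  have PiE: "f \<in> X \<rightarrow>\<^sub>E {1..Suc m}" "g \<in> X \<rightarrow>\<^sub>E {1..Suc m}"
    using fg by (auto simp: mono_maps_def)
  show "f = g"
  proof (rule PiE_ext[OF PiE])
    fix c assume c: "c \<in> X"
    then have "c \<notin> Y" using assms by blast
    then have "{1..Suc m} - {f c} = {1..Suc m} - {g c}"
      using c arg_cong[OF eq, of "\<lambda>D. column D c"] by (simp add: column_punctured[OF assms])
    then show "f c = g c" using PiE c by (metis Diff_iff PiE_mem insert_iff singletonD)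
  qed
qed

section \<open>Checkered diagrams\<close>

text \<open>In this parity form, rows and columns of the diagram can be read off directly.\<close>

lemma checkered1_altdef:
  "checkered1 n = {(r, c). 1 \<le> r \<and> r \<le> n \<and> 1 \<le> c \<and> c \<le> n \<and> (odd r \<longleftrightarrow> odd c)}"
proof (intro set_eqI iffI; clarify)
  fix r c assume "(r, c) \<in> checkered1 n"
  then show "1 \<le> r \<and> r \<le> n \<and> 1 \<le> c \<and> c \<le> n \<and> (odd r \<longleftrightarrow> odd c)"
    by (auto simp: checkered1_def)
next
  fix r c assume rc: "1 \<le> r" "r \<le> n" "1 \<le> c" "c \<le> n" "odd r \<longleftrightarrow> odd c"
  show "(r, c) \<in> checkered1 n"
  proof (cases "odd r")
    case True
    then obtain i j where "r = 2 * i + 1" "c = 2 * j + 1" using rc(5) by (metis oddE)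
    then show ?thesis using rc unfolding checkered1_def
      by (intro UnI1 CollectI exI[of _ "Suc i"] exI[of _ "Suc j"]) auto
  next
    case False
    then obtain i j where "r = 2 * i" "c = 2 * j" using rc(5) by (metis evenE)
    then show ?thesis using rc unfolding checkered1_def
      by (intro UnI2 CollectI exI[of _ i] exI[of _ j]) auto
  qed
qed

lemma checkered2_altdef:
  "checkered2 n = {(r, c). 1 \<le> r \<and> r \<le> n \<and> 1 \<le> c \<and> c \<le> n \<and> (odd r \<longleftrightarrow> even c)}"
proof (intro set_eqI iffI; clarify)
  fix r c assume "(r, c) \<in> checkered2 n"
  then show "1 \<le> r \<and> r \<le> n \<and> 1 \<le> c \<and> c \<le> n \<and> (odd r \<longleftrightarrow> even c)"
    by (auto simp: checkered2_def)
next
  fix r c assume rc: "1 \<le> r" "r \<le> n" "1 \<le> c" "c \<le> n" "odd r \<longleftrightarrow> even c"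
  show "(r, c) \<in> checkered2 n"
  proof (cases "odd r")
    case True
    then obtain i j where "r = 2 * i + 1" "c = 2 * j" using rc(5) by (metis oddE evenE)
    then show ?thesis using rc unfolding checkered2_def
      by (intro UnI1 CollectI exI[of _ "Suc i"] exI[of _ j]) auto
  next
    case False
    then obtain i j where "r = 2 * i" "c = 2 * j + 1" using rc(5) by (metis evenE oddE)
    then show ?thesis using rc unfolding checkered2_def
      by (intro UnI2 CollectI exI[of _ i] exI[of _ "Suc j"]) auto
  qed
qed

text \<open>No column has more than \<open>m\<close> cells, so a minimal diagram has no cell above
  row \<open>m\<close>; each column in \<open>C\<close> must then fill all \<open>m\<close> rows.
  Existence of a minimal element completes the count.\<close>

lemma card_kohnert_minimal_equal_columns:
  assumes D0: "is_diagram D0"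
    and card_col: "\<And>c. card (column D0 c) = (if c \<in> C then m else 0)"
  shows "card (kohnert_minimal D0) = 1"
proof -
  have "D = {1..m} \<times> C" if D: "D \<in> kohnert_minimal D0" for D
  proof -
    have KD: "D \<in> KD D0" using D by (simp add: kohnert_minimal_def)
    have dD: "is_diagram D" by (rule is_diagram_KD[OF KD D0])
    note card = card_column_KD[OF KD D0]
    have fin: "finite (column D c)" for c by (rule finite_column[OF dD])
    have sub: "column D c \<subseteq> {1..m}" for c
    proof
      fix r assume r: "r \<in> column D c"
      then obtain c' where "{1..r} \<subseteq> column D c'"
        using minimal_cell_below_full_column[OF D D0, of r c] by (auto simp: column_def)
      then have "r \<le> card (column D c')" using card_mono[OF fin, of "{1..r}" c'] by auto
      moreover have "1 \<le> r" using r dD by (auto simp: column_def is_diagram_def)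
      ultimately show "r \<in> {1..m}" by (auto simp: card card_col split: if_splits)
    qed
    have "column D c = (if c \<in> C then {1..m} else {})" for c
    proof (cases "c \<in> C")
      case True
      then have "column D c = {1..m}"
        using card[of c] card_col[of c] sub[of c] by (intro card_subset_eq) auto
      then show ?thesis using True by simp
    next
      case False
      then show ?thesis using card[of c] card_col[of c] fin[of c] by simp
    qed
    then show ?thesis by (auto simp: column_def set_eq_iff split: if_splits)
  qed
  then have "kohnert_minimal D0 = {{1..m} \<times> C}"
    using exists_kohnert_minimal[OF D0] by blast
  then show ?thesis by simp
qed

text \<open>Among \<open>2 * m\<close> rows, \<open>m\<close> are odd and \<open>m\<close> are even,
  so columns of both parities have the same size.\<close>

lemma card_kohnert_minimal_checkered_even:
  assumes "D0 = checkered1 (2 * m) \<or> D0 = checkered2 (2 * m)"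
  shows "card (kohnert_minimal D0) = 1"
proof (rule card_kohnert_minimal_equal_columns[of _ "{1..2 * m}" m])
  show "is_diagram D0" using assms is_diagram_checkered by blast
  fix c
  consider "c \<notin> {1..2 * m}" "column D0 c = {}"
    | "c \<in> {1..2 * m}" "column D0 c = {r. odd r \<and> 1 \<le> r \<and> r \<le> 2 * m}"
    | "c \<in> {1..2 * m}" "column D0 c = {r. even r \<and> 1 \<le> r \<and> r \<le> 2 * m}"
  proof (cases "c \<in> {1..2 * m}")
    case False
    then show ?thesis using assms that(1)
      by (auto simp: column_def checkered1_altdef checkered2_altdef)
  next
    case True
    have "column D0 c = {r. odd r \<and> 1 \<le> r \<and> r \<le> 2 * m} \<or>
      column D0 c = {r. even r \<and> 1 \<le> r \<and> r \<le> 2 * m}"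
      using assms True by (cases "odd c") (auto simp: column_def checkered1_altdef checkered2_altdef)
    then show ?thesis using that True by blast
  qed
  then show "card (column D0 c) = (if c \<in> {1..2 * m} then m else 0)"
    by cases (simp_all add: card_odd_rows_even card_even_rows del: One_nat_def)
qed

text \<open>The last column belongs to \<open>Y\<close> and lies to the right of all of
  \<open>X\<close>, so no hole is forced and every increasing map on the \<open>m\<close> columns of
  \<open>X\<close> counts.\<close>

lemma card_kohnert_minimal_checkered1_odd:
  "card (kohnert_minimal (checkered1 (2 * m + 1))) = (2 * m) choose m"
proof -
  define X where "X = {c. even c \<and> 1 \<le> c \<and> c \<le> 2 * m}"
  define Y where "Y = {c. odd c \<and> 1 \<le> c \<and> c \<le> 2 * m + 1}"
  have XY: "finite X" "finite Y" "X \<inter> Y = {}" "0 \<notin> X" "0 \<notin> Y" by (auto simp: X_def Y_def)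
  have eq: "checkered1 (2 * m + 1) = striped m X Y"
    by (auto simp: checkered1_altdef of_rows_def striped_row_def X_def Y_def le_Suc_eq
        split: if_splits)
  have top: "2 * m + 1 \<in> Y" "c \<in> X \<Longrightarrow> c < 2 * m + 1" for c by (auto simp: X_def Y_def)
  have "{f \<in> mono_maps X (Suc m). \<forall>c\<in>X. (\<forall>y\<in>Y. y < c) \<longrightarrow> f c = Suc m} = mono_maps X (Suc m)"
    using top by force
  then have "card (kohnert_minimal (checkered1 (2 * m + 1))) = card (mono_maps X (Suc m))"
    unfolding eq kohnert_minimal_striped[OF XY] by (simp add: card_image inj_on_punctured[OF XY(3)])
  also have "card X = m" unfolding X_def by (rule card_even_rows)
  then have "card (mono_maps X (Suc m)) = (2 * m) choose m"
    by (simp add: card_mono_maps[OF XY(1)] mult_2)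
  finally show ?thesis .
qed

text \<open>Here \<open>X\<close> has \<open>m + 1\<close> columns, but the last one,
  \<open>b\<close>, lies to the right of all of \<open>Y\<close>. Its hole is forced to the top,
  which leaves the \<open>m\<close> columns of \<open>Z\<close> free.\<close>

lemma card_kohnert_minimal_checkered2_odd:
  "card (kohnert_minimal (checkered2 (2 * m + 1))) = (2 * m) choose m"
proof -
  define b where "b = 2 * m + 1"
  define Z where "Z = {c. odd c \<and> 1 \<le> c \<and> c \<le> 2 * m}"
  define X where "X = insert b Z"
  define Y where "Y = {c. even c \<and> 1 \<le> c \<and> c \<le> 2 * m}"
  have XY: "finite X" "finite Y" "X \<inter> Y = {}" "0 \<notin> X" "0 \<notin> Y"
    by (auto simp: X_def Y_def Z_def b_def)
  have Z: "finite Z" "\<And>c. c \<in> Z \<Longrightarrow> c < b" "card Z = m"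
    using card_odd_rows_even[of m] by (auto simp: Z_def b_def)
  have eq: "checkered2 (2 * m + 1) = striped m X Y"
    by (auto simp: checkered2_altdef of_rows_def striped_row_def X_def Y_def Z_def b_def le_Suc_eq
        split: if_splits)
  have "(\<forall>y\<in>Y. y < c) \<longleftrightarrow> c = b" if "c \<in> X" for c
  proof
    assume c: "\<forall>y\<in>Y. y < c"
    show "c = b"
    proof (rule ccontr)
      assume "c \<noteq> b"
      \<comment> \<open>Every column of \<open>X\<close> other than \<open>b\<close> is followed
        directly by a column of \<open>Y\<close>.\<close>
      then have "Suc c \<in> Y" using that by (auto simp: X_def Y_def Z_def le_less)
      then show False using c by auto
    qed
  qed (auto simp: Y_def b_def)
  then have F: "{f \<in> mono_maps X (Suc m). \<forall>c\<in>X. (\<forall>y\<in>Y. y < c) \<longrightarrow> f c = Suc m} =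
      {f \<in> mono_maps (insert b Z) (Suc m). f b = Suc m}"
    by (auto simp: X_def)
  have "card (kohnert_minimal (checkered2 (2 * m + 1))) =
      card {f \<in> mono_maps (insert b Z) (Suc m). f b = Suc m}"
    unfolding eq kohnert_minimal_striped[OF XY] F
    by (intro card_image inj_on_subset[OF inj_on_punctured[OF XY(3)]]) (auto simp: X_def)
  also have "\<dots> = card (mono_maps Z (Suc m))" using Z by (intro card_mono_maps_top) auto
  also have "\<dots> = (2 * m) choose m" by (simp add: card_mono_maps[OF Z(1)] Z(3) mult_2)
  finally show ?thesis .
qed

theorem theorem7p2:
  fixes n :: nat and D0 :: diagram
  assumes "n \<ge> 1"
    and "D0 = checkered1 n \<or> D0 = checkered2 n"
  shows "(even n \<longrightarrow> card (kohnert_minimal D0) = 1) \<and>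
    (odd n \<longrightarrow> card (kohnert_minimal D0) = (2 * (n div 2)) choose (n div 2))"
proof (intro conjI impI)
  assume "even n"
  then show "card (kohnert_minimal D0) = 1"
    using assms(2) card_kohnert_minimal_checkered_even by (metis evenE)
next
  assume "odd n"
  then obtain m where n: "n = 2 * m + 1" by (rule oddE)
  then have "n div 2 = m" by simp
  then show "card (kohnert_minimal D0) = (2 * (n div 2)) choose (n div 2)"
    using assms(2) card_kohnert_minimal_checkered1_odd[of m]
      card_kohnert_minimal_checkered2_odd[of m] n by auto
qed

end
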